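(* Let $L>0$ and let $F:\mathbb{R}^d\to\mathbb{R}^d$ be an affine, monotone and $L$-Lipschitz operator. Let $0<\gamma\le \frac1L$ and $F_{\mathrm{EG},\gamma}(x)=F\left(x-\gamma F(x)\right)$. Then every nonzero eigenvalue $\lambda\in\mathbb{C}$ of the (constant) Jacobian $\nabla F_{\mathrm{EG},\gamma}$ satisfies $\mathrm{Re}(1/\lambda)\ge \frac{\gamma}{2}$. Moreover, $F_{\mathrm{EG},\gamma}$ is $\frac{2}{\gamma}$-cocoercive.
   Context: $\langle\cdot,\cdot\rangle$ and $\|\cdot\|$ are the standard Euclidean inner product and norm. $F$ is affine if $F(x)=\mathbf{A}x+b$ for some $\mathbf{A}\in\mathbb{R}^{d\times d}$, $b\in\mathbb{R}^d$. $F$ is monotone if $\langle F(x)-F(x'),x-x'\rangle\ge 0$ for all $x,x'$, and $L$-Lipschitz if $\|F(x)-F(x')\|\le L\|x-x'\|$ for all $x,x'$. An operator $G:\mathbb{R}^d\to\mathbb{R}^d$ is $\ell$-cocoercive if $\|G(x)-G(x')\|^2\le \ell\langle G(x)-G(x'),x-x'\rangle$ for all $x,x'\in\mathbb{R}^d$. *)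

theory Defs
  imports "HOL-Analysis.Analysis"
begin

definition affine_operator :: "(real^'d \<Rightarrow> real^'d) \<Rightarrow> bool" where
  "affine_operator F \<longleftrightarrow> (\<exists>(A::real^'d^'d) b. \<forall>x. F x = A *v x + b)"

(* Monotonicity in the sense of operators on Euclidean space; unrelated to the order-theoretic mono. *)
definition monotone_operator :: "(real^'d \<Rightarrow> real^'d) \<Rightarrow> bool" where
  "monotone_operator F \<longleftrightarrow> (\<forall>x x'. (F x - F x') \<bullet> (x - x') \<ge> 0)"

definition cocoercive :: "real \<Rightarrow> (real^'d \<Rightarrow> real^'d) \<Rightarrow> bool" where
  "cocoercive l G \<longleftrightarrow>
     (\<forall>x x'. (norm (G x - G x'))\<^sup>2 \<le> l * ((G x - G x') \<bullet> (x - x')))"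

definition extragradient :: "real \<Rightarrow> (real^'d \<Rightarrow> real^'d) \<Rightarrow> real^'d \<Rightarrow> real^'d" where
  "extragradient \<gamma> F x = F (x - \<gamma> *\<^sub>R F x)"

(* Complex eigenvalues of a real matrix: eigenvectors are taken in the complexified space. *)
definition complex_eigenvalue :: "real^'d^'d \<Rightarrow> complex \<Rightarrow> bool" where
  "complex_eigenvalue M \<mu> \<longleftrightarrow>
     (\<exists>v::complex^'d. v \<noteq> 0 \<and> map_matrix complex_of_real M *v v = \<mu> *s v)"

end

theory Submission
  imports Defs
begin

text \<open>Put \<open>G = F\<^sub>E\<^sub>G\<close>, \<open>f = F x - F x'\<close> and \<open>g = G x - G x'\<close>. Monotonicity of \<open>F\<close> at the extrapolated
  points gives \<open>g \<bullet> (x - x') \<ge> \<gamma> g \<bullet> f\<close>. Since \<open>F\<close> is affine, \<open>g - f = - \<gamma> A f\<close>, so \<open>norm (g - f) \<le> norm f\<close>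
  because \<open>\<gamma> L \<le> 1\<close>, and polarisation turns this into \<open>2 g \<bullet> f \<ge> (norm g)\<^sup>2\<close>. For the spectral bound,
  cocoercivity is applied to the real and imaginary parts of an eigenvector of the Jacobian
  and the two inequalities are added; this yields \<open>(cmod \<mu>)\<^sup>2 \<le> 2 / \<gamma> * Re \<mu>\<close>.\<close>

text \<open>Expanding \<open>A *v (x - \<gamma> *\<^sub>R (A *v x + b)) + b\<close> leaves a
  constant independent of \<open>x\<close>. It is written as the value at 0, so that it cancels in
  differences without being computed.\<close>

lemma extragradient_affine:
  fixes A :: "real^'d^'d"
  assumes "\<And>x. F x = A *v x + b"
  shows "extragradient \<gamma> F x = (A - \<gamma> *\<^sub>R (A ** A)) *v x + extragradient \<gamma> F 0"
  by (simp add: extragradient_def assms matrix_vector_mult_diff_rdistrib vec.neg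
      matrix_vector_mult_diff_distrib matrix_vector_right_distrib matrix_vector_mult_scaleR
      scaleR_matrix_vector_assoc[symmetric] matrix_vector_mul_assoc algebra_simps)

lemma has_derivative_affine:
  fixes M :: "real^'m^'n"
  assumes "\<And>x. G x = M *v x + c"
  shows "(G has_derivative (*v) M) (at x)"
proof -
  have "((\<lambda>x. M *v x + c) has_derivative (*v) M) (at x)"
    by (intro has_derivative_add_const bounded_linear_imp_has_derivative matrix_vector_mul_bounded_linear)
  moreover have "G = (\<lambda>x. M *v x + c)"
    using assms by auto
  ultimately show ?thesis
    by simp
qed

lemma jacobian_eqI:
  fixes M :: "real^'m^'n"
  assumes "(G has_derivative (*v) M) (at x)"
  shows "jacobian G (at x) = M"
  by (simp add: jacobian_def frechet_derivative_at[OF assms, symmetric])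

lemma cocoercive_extragradient:
  fixes F :: "real^'d \<Rightarrow> real^'d"
  assumes "affine_operator F" and mono: "monotone_operator F"
    and lip: "L-lipschitz_on UNIV F" and "0 < \<gamma>" and "\<gamma> * L \<le> 1"
  shows "cocoercive (2 / \<gamma>) (extragradient \<gamma> F)"
  unfolding cocoercive_def
proof (intro allI)
  fix x x'
  obtain A b where A: "\<And>x. F x = A *v x + b"
    using assms(1) unfolding affine_operator_def by blast
  define f where "f = F x - F x'"
  define g where "g = extragradient \<gamma> F x - extragradient \<gamma> F x'"
  have "0 \<le> g \<bullet> ((x - \<gamma> *\<^sub>R F x) - (x' - \<gamma> *\<^sub>R F x'))"
    using mono unfolding g_def extragradient_def monotone_operator_def by blast
  also have "(x - \<gamma> *\<^sub>R F x) - (x' - \<gamma> *\<^sub>R F x') = (x - x') - \<gamma> *\<^sub>R f"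
    by (simp add: f_def algebra_simps)
  finally have step: "\<gamma> * (g \<bullet> f) \<le> g \<bullet> (x - x')"
    by (simp add: inner_diff_right)
  \<comment> \<open>The difference vector \<open>f\<close> is used here as a point:
    \<open>F f - F 0 = A *v f\<close>, so the Lipschitz bound for \<open>F\<close> bounds the linear
    part on \<open>f\<close>.\<close>
  have "norm (A *v f) \<le> L * norm f"
    using lipschitz_onD[OF lip, of f 0] by (simp add: A dist_norm)
  \<comment> \<open>The extrapolated points differ by
    \<open>(x - x') - \<gamma> *\<^sub>R f\<close>, and \<open>A\<close> maps \<open>x - x'\<close>
    to \<open>f\<close>.\<close>
  moreover have "g - f = - (\<gamma> *\<^sub>R (A *v f))"
    by (simp add: g_def f_def extragradient_def A matrix_vector_mult_diff_distrib
        matrix_vector_right_distrib matrix_vector_mult_scaleR algebra_simps)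
  ultimately have "norm (g - f) \<le> \<gamma> * (L * norm f)"
    using \<open>0 < \<gamma>\<close> by simp
  also have "\<dots> \<le> norm f"
    using mult_right_mono[OF \<open>\<gamma> * L \<le> 1\<close>, of "norm f"] by (simp add: mult.assoc)
  finally have "(norm (g - f))\<^sup>2 \<le> (norm f)\<^sup>2"
    by (simp add: power_mono)
  \<comment> \<open>Expanding the square on the left, the term \<open>f \<bullet> f\<close>
    cancels.\<close>
  then have "(norm g)\<^sup>2 \<le> 2 * (g \<bullet> f)"
    by (simp add: power2_norm_eq_inner inner_diff_left inner_diff_right inner_commute)
  then have "\<gamma> * (norm g)\<^sup>2 \<le> \<gamma> * (2 * (g \<bullet> f))"
    using \<open>0 < \<gamma>\<close> by simp
  with step have "\<gamma> * (norm g)\<^sup>2 \<le> 2 * (g \<bullet> (x - x'))"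
    by simp
  then have "(norm g)\<^sup>2 \<le> 2 / \<gamma> * (g \<bullet> (x - x'))"
    using \<open>0 < \<gamma>\<close> by (simp add: field_simps)
  then show "(norm (extragradient \<gamma> F x - extragradient \<gamma> F x'))\<^sup>2
      \<le> 2 / \<gamma> * ((extragradient \<gamma> F x - extragradient \<gamma> F x') \<bullet> (x - x'))"
    by (simp only: g_def)
qed

text \<open>Since \<open>M\<close> has real entries, taking real or imaginary parts commutes with
  applying it. On the span of the two parts, \<open>M\<close> thus mimics multiplication by
  \<open>\<mu>\<close>.\<close>

lemma complex_eigenvector_parts:
  fixes M :: "real^'d^'d"
  assumes "map_matrix complex_of_real M *v v = \<mu> *s v"
  shows "M *v (\<chi> i. Re (v $ i)) = Re \<mu> *\<^sub>R (\<chi> i. Re (v $ i)) - Im \<mu> *\<^sub>R (\<chi> i. Im (v $ i))"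
    and "M *v (\<chi> i. Im (v $ i)) = Im \<mu> *\<^sub>R (\<chi> i. Re (v $ i)) + Re \<mu> *\<^sub>R (\<chi> i. Im (v $ i))"
proof -
  have eq: "(\<Sum>j\<in>UNIV. complex_of_real (M $ i $ j) * v $ j) = \<mu> * v $ i" for i
    using arg_cong[OF assms, of "\<lambda>w. w $ i"] by (simp add: matrix_vector_mult_def map_matrix_def)
  show "M *v (\<chi> i. Re (v $ i)) = Re \<mu> *\<^sub>R (\<chi> i. Re (v $ i)) - Im \<mu> *\<^sub>R (\<chi> i. Im (v $ i))"
    using arg_cong[OF eq, of Re] by (simp add: vec_eq_iff matrix_vector_mult_def)
  show "M *v (\<chi> i. Im (v $ i)) = Im \<mu> *\<^sub>R (\<chi> i. Re (v $ i)) + Re \<mu> *\<^sub>R (\<chi> i. Im (v $ i))"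
    using arg_cong[OF eq, of Im] by (simp add: vec_eq_iff matrix_vector_mult_def add.commute)
qed

lemma Re_inverse_complex_eigenvalue:
  fixes M :: "real^'d^'d"
  assumes "l > 0" and coco: "\<And>x. (norm (M *v x))\<^sup>2 \<le> l * ((M *v x) \<bullet> x)"
    and "complex_eigenvalue M \<mu>" and "\<mu> \<noteq> 0"
  shows "Re (1 / \<mu>) \<ge> 1 / l"
proof -
  obtain v where "v \<noteq> 0" and v: "map_matrix complex_of_real M *v v = \<mu> *s v"
    using assms(3) unfolding complex_eigenvalue_def by blast
  define p where "p = (\<chi> i. Re (v $ i))"
  define q where "q = (\<chi> i. Im (v $ i))"
  define s where "s = p \<bullet> p + q \<bullet> q"
  have "p \<noteq> 0 \<or> q \<noteq> 0"
    using \<open>v \<noteq> 0\<close> by (auto simp: p_def q_def vec_eq_iff complex_eq_iff)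
  then have "s > 0"
    unfolding s_def by (metis add_nonneg_pos add_pos_nonneg inner_ge_zero inner_gt_zero_iff)
  have Mp: "M *v p = Re \<mu> *\<^sub>R p - Im \<mu> *\<^sub>R q" and Mq: "M *v q = Im \<mu> *\<^sub>R p + Re \<mu> *\<^sub>R q"
    using complex_eigenvector_parts[OF v] by (simp_all add: p_def q_def)
  \<comment> \<open>Each square contains a multiple of \<open>p \<bullet> q\<close>, with opposite
    signs, so the cross terms vanish only in the sum. The same happens for the inner products
    below.\<close>
  have "(norm (M *v p))\<^sup>2 + (norm (M *v q))\<^sup>2 = ((Re \<mu>)\<^sup>2 + (Im \<mu>)\<^sup>2) * s"
    unfolding Mp Mq s_def power2_norm_eq_inner
    by (simp add: inner_diff_left inner_diff_right inner_add_left inner_add_right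
        inner_commute power2_eq_square algebra_simps)
  then have "(norm (M *v p))\<^sup>2 + (norm (M *v q))\<^sup>2 = (cmod \<mu>)\<^sup>2 * s"
    by (simp only: cmod_power2)
  moreover have "(M *v p) \<bullet> p + (M *v q) \<bullet> q = Re \<mu> * s"
    by (simp add: Mp Mq s_def inner_diff_left inner_add_left inner_commute algebra_simps)
  ultimately have "(cmod \<mu>)\<^sup>2 * s \<le> l * Re \<mu> * s"
    using add_mono[OF coco[of p] coco[of q]] by (simp flip: distrib_left)
  then have "(cmod \<mu>)\<^sup>2 \<le> l * Re \<mu>"
    using \<open>s > 0\<close> by simp
  moreover have "(cmod \<mu>)\<^sup>2 > 0"
    using \<open>\<mu> \<noteq> 0\<close> by simp
  \<comment> \<open>\<open>Re (1 / \<mu>)\<close> equals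
    \<open>Re \<mu> / (cmod \<mu>)\<^sup>2\<close>.\<close>
  ultimately show ?thesis
    using \<open>l > 0\<close> by (simp add: Re_divide flip: cmod_power2) (simp add: field_simps)
qed

theorem lemmaD1:
  fixes F :: "real^'d \<Rightarrow> real^'d" and L \<gamma> :: real
  assumes "L > 0"
    and "affine_operator F"
    and "monotone_operator F"
    and "L-lipschitz_on UNIV F"
    and "0 < \<gamma>" and "\<gamma> \<le> 1 / L"
  shows "(\<exists>J. (\<forall>x. extragradient \<gamma> F differentiable (at x)
                 \<and> jacobian (extragradient \<gamma> F) (at x) = J)
            \<and> (\<forall>\<mu>. complex_eigenvalue J \<mu> \<and> \<mu> \<noteq> 0 \<longrightarrow> Re (1 / \<mu>) \<ge> \<gamma> / 2))
         \<and> cocoercive (2 / \<gamma>) (extragradient \<gamma> F)"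
proof
  have "\<gamma> * L \<le> 1"
    using \<open>L > 0\<close> \<open>\<gamma> \<le> 1 / L\<close> by (simp add: field_simps)
  with assms show coco: "cocoercive (2 / \<gamma>) (extragradient \<gamma> F)"
    by (intro cocoercive_extragradient)
  obtain A b where A: "\<And>x. F x = A *v x + b"
    using \<open>affine_operator F\<close> unfolding affine_operator_def by blast
  define J where "J = A - \<gamma> *\<^sub>R (A ** A)"
  have affine: "extragradient \<gamma> F x = J *v x + extragradient \<gamma> F 0" for x
    unfolding J_def by (rule extragradient_affine[OF A])
  have deriv: "(extragradient \<gamma> F has_derivative (*v) J) (at x)" for x
    using affine by (rule has_derivative_affine)
  have "extragradient \<gamma> F x - extragradient \<gamma> F 0 = J *v x" for x
    using affine[of x] by simp
  \<comment> \<open>Cocoercivity with second point 0 becomes a statement about the linear part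
    \<open>J\<close>.\<close>
  then have "(norm (J *v x))\<^sup>2 \<le> 2 / \<gamma> * ((J *v x) \<bullet> x)" for x
    using coco unfolding cocoercive_def by (metis diff_zero)
  then have "Re (1 / \<mu>) \<ge> \<gamma> / 2" if "complex_eigenvalue J \<mu>" "\<mu> \<noteq> 0" for \<mu>
    using Re_inverse_complex_eigenvalue[of "2 / \<gamma>" J \<mu>] that \<open>0 < \<gamma>\<close> by simp
  moreover have "extragradient \<gamma> F differentiable (at x)
      \<and> jacobian (extragradient \<gamma> F) (at x) = J" for x
    using differentiableI[OF deriv] jacobian_eqI[OF deriv] by blast
  ultimately show "\<exists>J. (\<forall>x. extragradient \<gamma> F differentiable (at x)
                 \<and> jacobian (extragradient \<gamma> F) (at x) = J)
            \<and> (\<forall>\<mu>. complex_eigenvalue J \<mu> \<and> \<mu> \<noteq> 0 \<longrightarrow> Re (1 / \<mu>) \<ge> \<gamma> / 2)"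
    by blast
qed

end
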